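(* Let $(G,B)$ be a free Rota--Baxter group generated by a set $X$. Denote by $S$ the skew left subbrace of $G(B)=(G,\cdot,\circ_B)$ generated by $X$. Then $S$ is a free skew left brace generated by $X$.
   Context: A Rota--Baxter group is a group $(G,\cdot)$ endowed with a map $B\colon G\to G$ such that $B(g)B(h)=B(gB(g)hB(g)^{-1})$ for all $g,h\in G$. A free Rota--Baxter group generated by $X$ is the free algebraic structure on $X$ in the variety of Rota--Baxter groups, in the signature $\langle\cdot,{}^{-1},B\rangle$ with one binary and two unary operations (homomorphisms are group homomorphisms commuting with the operators $B$). A skew left brace is a set $A$ with two binary operations $\cdot$ and $\circ$ such that $(A,\cdot)$ and $(A,\circ)$ are groups and $a\circ(b\cdot c)=(a\circ b)\cdot a^{-1}\cdot(a\circ c)$ for all $a,b,c\in A$, where $a^{-1}$ is the inverse of $a$ in $(A,\cdot)$. A skew left subbrace is a subset that is a subgroup with respect to both operations; the free skew left brace generated by $X$ is the free object on $X$ in the variety of skew left braces (homomorphisms preserve both operations). For a Rota--Baxter group $(G,\cdot,B)$, $G(B)=(G,\cdot,\circ_B)$ with $x\circ_B y=xB(x)yB(x)^{-1}$, which is a skew left brace. *)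

theory Defs
  imports "HOL-Algebra.Group"
begin

section \<open>Rota--Baxter groups\<close>

locale rota_baxter_group = group G for G (structure) +
  fixes B
  assumes op_closed: "B \<in> carrier G \<rightarrow> carrier G"
    and op_mult: "\<lbrakk>g \<in> carrier G; h \<in> carrier G\<rbrakk> \<Longrightarrow>
      B g \<otimes> B h = B (g \<otimes> B g \<otimes> h \<otimes> inv B g)"

definition rota_baxter_hom ::
  "('a, 'm) monoid_scheme \<Rightarrow> ('a \<Rightarrow> 'a) \<Rightarrow> ('b, 'n) monoid_scheme \<Rightarrow> ('b \<Rightarrow> 'b) \<Rightarrow> ('a \<Rightarrow> 'b) set"
  where "rota_baxter_hom G B H C = {\<phi> \<in> hom G H. \<forall>g\<in>carrier G. \<phi> (B g) = C (\<phi> g)}"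

text \<open>
  The universal property, tested on the Rota--Baxter groups whose elements have type \<open>'b\<close>:
  HOL cannot quantify over all types inside a formula. Homomorphisms are taken extensional
  (fixed outside the carrier), so that uniqueness means uniqueness on the carrier.
\<close>

definition free_rota_baxter_group ::
  "'b itself \<Rightarrow> ('a, 'm) monoid_scheme \<Rightarrow> ('a \<Rightarrow> 'a) \<Rightarrow> 'a set \<Rightarrow> bool"
  where "free_rota_baxter_group (_ :: 'b itself) G B X \<longleftrightarrow>
    rota_baxter_group G B \<and> X \<subseteq> carrier G \<and>
    (\<forall>(H :: 'b monoid) C f. rota_baxter_group H C \<and> f \<in> X \<rightarrow> carrier H \<longrightarrow>
      (\<exists>!\<phi>. \<phi> \<in> rota_baxter_hom G B H C \<inter> extensional (carrier G) \<and> (\<forall>x\<in>X. \<phi> x = f x)))"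

section \<open>Skew left braces\<close>

text \<open>
  A skew left brace is given by its two group structures \<open>A\<close> (for \<open>\<cdot>\<close>) and \<open>C\<close> (for \<open>\<circ>\<close>)
  on the same carrier.
\<close>

locale skew_left_brace = A: group A + C: group C for A and C +
  assumes carrier_eq: "carrier C = carrier A"
    and compat: "\<lbrakk>a \<in> carrier A; b \<in> carrier A; c \<in> carrier A\<rbrakk> \<Longrightarrow>
      a \<otimes>\<^bsub>C\<^esub> (b \<otimes>\<^bsub>A\<^esub> c) = (a \<otimes>\<^bsub>C\<^esub> b) \<otimes>\<^bsub>A\<^esub> inv\<^bsub>A\<^esub> a \<otimes>\<^bsub>A\<^esub> (a \<otimes>\<^bsub>C\<^esub> c)"

definition skew_left_brace_hom ::
  "('a, 'm) monoid_scheme \<Rightarrow> ('a, 'n) monoid_scheme \<Rightarrow>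
   ('b, 'k) monoid_scheme \<Rightarrow> ('b, 'l) monoid_scheme \<Rightarrow> ('a \<Rightarrow> 'b) set"
  where "skew_left_brace_hom A C A' C' = hom A A' \<inter> hom C C'"

definition skew_left_subbrace ::
  "'a set \<Rightarrow> ('a, 'm) monoid_scheme \<Rightarrow> ('a, 'n) monoid_scheme \<Rightarrow> bool"
  where "skew_left_subbrace S A C \<longleftrightarrow> subgroup S A \<and> subgroup S C"

definition skew_left_subbrace_generated ::
  "('a, 'm) monoid_scheme \<Rightarrow> ('a, 'n) monoid_scheme \<Rightarrow> 'a set \<Rightarrow> 'a set"
  where "skew_left_subbrace_generated A C X = \<Inter>{S. skew_left_subbrace S A C \<and> X \<subseteq> S}"

definition free_skew_left_brace ::
  "'b itself \<Rightarrow> ('a, 'm) monoid_scheme \<Rightarrow> ('a, 'n) monoid_scheme \<Rightarrow> 'a set \<Rightarrow> bool"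
  where "free_skew_left_brace (_ :: 'b itself) A C X \<longleftrightarrow>
    skew_left_brace A C \<and> X \<subseteq> carrier A \<and>
    (\<forall>(A' :: 'b monoid) (C' :: 'b monoid) f. skew_left_brace A' C' \<and> f \<in> X \<rightarrow> carrier A' \<longrightarrow>
      (\<exists>!\<phi>. \<phi> \<in> skew_left_brace_hom A C A' C' \<inter> extensional (carrier A) \<and> (\<forall>x\<in>X. \<phi> x = f x)))"

section \<open>The skew left brace of a Rota--Baxter group\<close>

definition circ_group :: "('a, 'm) monoid_scheme \<Rightarrow> ('a \<Rightarrow> 'a) \<Rightarrow> 'a monoid"
  where "circ_group G B =
    \<lparr>carrier = carrier G,
     mult = (\<lambda>x y. x \<otimes>\<^bsub>G\<^esub> B x \<otimes>\<^bsub>G\<^esub> y \<otimes>\<^bsub>G\<^esub> inv\<^bsub>G\<^esub> B x),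
     one = \<one>\<^bsub>G\<^esub>\<rparr>"

context rota_baxter_group
begin

lemma op_in [simp, intro]: "g \<in> carrier G \<Longrightarrow> B g \<in> carrier G"
  using op_closed by auto

lemma op_one [simp]: "B \<one> = \<one>"
proof -
  have "B \<one> \<otimes> B \<one> = B \<one>"
    using op_mult[of \<one> \<one>] by simp
  then show ?thesis
    using r_cancel_one'[of "B \<one>" "B \<one>"] by simp
qed

lemma cancel_inv [simp]:
  assumes "x \<in> carrier G" "y \<in> carrier G"
  shows "x \<otimes> (inv x \<otimes> y) = y" "inv x \<otimes> (x \<otimes> y) = y"
  using assms by (simp_all add: m_assoc[symmetric])

lemma skew_left_brace_circ_group: "skew_left_brace G (circ_group G B)"
proof -
  have grp: "group (circ_group G B)"
  proof (rule groupI)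
    fix x y z
    assume "x \<in> carrier (circ_group G B)" "y \<in> carrier (circ_group G B)"
      "z \<in> carrier (circ_group G B)"
    then have xyz: "x \<in> carrier G" "y \<in> carrier G" "z \<in> carrier G"
      by (simp_all add: circ_group_def)
    have "B (x \<otimes> B x \<otimes> y \<otimes> inv B x) = B x \<otimes> B y"
      using op_mult xyz by simp
    then show "x \<otimes>\<^bsub>circ_group G B\<^esub> y \<otimes>\<^bsub>circ_group G B\<^esub> z
        = x \<otimes>\<^bsub>circ_group G B\<^esub> (y \<otimes>\<^bsub>circ_group G B\<^esub> z)"
      using xyz by (simp add: circ_group_def m_assoc inv_mult_group)
  next
    fix x assume "x \<in> carrier (circ_group G B)"
    then have x: "x \<in> carrier G" by (simp add: circ_group_def)
    define y where "y = inv B x \<otimes> inv x \<otimes> B x"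
    have y: "y \<in> carrier G" using x by (simp add: y_def)
    have xy: "x \<otimes> B x \<otimes> y \<otimes> inv B x = \<one>"
      using x by (simp add: y_def m_assoc)
    have "B x \<otimes> B y = \<one>"
      using op_mult[OF x y] xy by simp
    then have By: "B y = inv B x"
      using x y by (metis inv_equality inv_comm op_in)
    have "y \<otimes> B y \<otimes> x \<otimes> inv B y = \<one>"
      using x unfolding By by (simp add: y_def m_assoc)
    then show "\<exists>y\<in>carrier (circ_group G B). y \<otimes>\<^bsub>circ_group G B\<^esub> x = \<one>\<^bsub>circ_group G B\<^esub>"
      using y by (auto simp: circ_group_def)
  qed (auto simp: circ_group_def)
  show ?thesis
  proof (intro skew_left_brace.intro skew_left_brace_axioms.intro)
    fix a b c assume "a \<in> carrier G" "b \<in> carrier G" "c \<in> carrier G"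
    then show "a \<otimes>\<^bsub>circ_group G B\<^esub> (b \<otimes> c)
        = a \<otimes>\<^bsub>circ_group G B\<^esub> b \<otimes> inv a \<otimes> (a \<otimes>\<^bsub>circ_group G B\<^esub> c)"
      by (simp add: circ_group_def m_assoc)
  qed (use grp is_group in \<open>simp_all add: circ_group_def\<close>)
qed

end

section \<open>Freeness tested on one large enough type\<close>

text \<open>
  Classes of terms in the signature of Rota--Baxter groups; the constant \<open>One\<close> provides the
  term needed over an empty set of generators. The free Rota--Baxter group on
  a subset of \<open>'a\<close> has a copy with elements of type \<open>'a rb_term set\<close>, and so has every
  Rota--Baxter group on \<open>'a\<close>; hence the universal property for this one type implies the
  universal property for all types (\<open>free_rota_baxter_group_all_types\<close> below).
\<close>

datatype 'a rb_term =
    Gen 'a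
  | One
  | Mul "'a rb_term" "'a rb_term"
  | Inv "'a rb_term"
  | Op "'a rb_term"

inductive rb_eq :: "'a rb_term \<Rightarrow> 'a rb_term \<Rightarrow> bool" where
  refl: "rb_eq s s"
| sym: "rb_eq s t \<Longrightarrow> rb_eq t s"
| trans: "rb_eq s t \<Longrightarrow> rb_eq t u \<Longrightarrow> rb_eq s u"
| Mul: "rb_eq s s' \<Longrightarrow> rb_eq t t' \<Longrightarrow> rb_eq (Mul s t) (Mul s' t')"
| Inv: "rb_eq s s' \<Longrightarrow> rb_eq (Inv s) (Inv s')"
| Op: "rb_eq s s' \<Longrightarrow> rb_eq (Op s) (Op s')"
| assoc: "rb_eq (Mul (Mul s t) u) (Mul s (Mul t u))"
| l_one: "rb_eq (Mul One s) s"
| l_inv: "rb_eq (Mul (Inv s) s) One"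
| rota_baxter: "rb_eq (Mul (Op s) (Op t)) (Op (Mul (Mul (Mul s (Op s)) t) (Inv (Op s))))"

definition rb_class :: "'a rb_term \<Rightarrow> 'a rb_term set"
  where "rb_class t = {s. rb_eq t s}"

definition rb_rep :: "'a rb_term set \<Rightarrow> 'a rb_term"
  where "rb_rep c = (SOME t. t \<in> c)"

definition rb_quot :: "'a rb_term set monoid"
  where "rb_quot = \<lparr>carrier = range rb_class,
    mult = (\<lambda>c d. rb_class (Mul (rb_rep c) (rb_rep d))), one = rb_class One\<rparr>"

definition rb_quot_op :: "'a rb_term set \<Rightarrow> 'a rb_term set"
  where "rb_quot_op c = rb_class (Op (rb_rep c))"

lemma rb_class_eq: "rb_class s = rb_class t \<longleftrightarrow> rb_eq s t"
  unfolding rb_class_def by (auto intro: rb_eq.refl rb_eq.sym rb_eq.trans)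

lemma rb_rep_class: "rb_eq (rb_rep (rb_class t)) t"
proof -
  have "rb_rep (rb_class t) \<in> rb_class t"
    unfolding rb_rep_def by (rule someI[of _ t]) (simp add: rb_class_def rb_eq.refl)
  then show ?thesis by (simp add: rb_class_def rb_eq.sym)
qed

lemma rb_quot_simps:
  "carrier rb_quot = range rb_class"
  "rb_class s \<otimes>\<^bsub>rb_quot\<^esub> rb_class t = rb_class (Mul s t)"
  "\<one>\<^bsub>rb_quot\<^esub> = rb_class One"
  "rb_quot_op (rb_class t) = rb_class (Op t)"
  by (simp_all add: rb_quot_def rb_quot_op_def rb_class_eq rb_eq.Mul rb_eq.Op rb_rep_class)

lemma group_rb_quot: "group (rb_quot :: 'a rb_term set monoid)"
proof (rule groupI)
  fix x :: "'a rb_term set" assume "x \<in> carrier rb_quot"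
  then obtain t where "x = rb_class t" by (auto simp: rb_quot_simps)
  then show "\<exists>y\<in>carrier rb_quot. y \<otimes>\<^bsub>rb_quot\<^esub> x = \<one>\<^bsub>rb_quot\<^esub>"
    by (intro bexI[of _ "rb_class (Inv t)"])
      (auto simp: rb_quot_simps rb_class_eq rb_eq.l_inv)
qed (clarsimp simp: rb_quot_simps rb_class_eq rb_eq.assoc rb_eq.l_one rangeI)+

lemma inv_rb_quot: "inv\<^bsub>rb_quot\<^esub> (rb_class t) = rb_class (Inv t)"
  by (rule group.inv_equality[OF group_rb_quot])
    (auto simp: rb_quot_simps rb_class_eq rb_eq.l_inv)

lemma rota_baxter_rb_quot: "rota_baxter_group rb_quot rb_quot_op"
  by (intro rota_baxter_group.intro group_rb_quot rota_baxter_group_axioms.intro)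
    (clarsimp simp: rb_quot_simps inv_rb_quot rb_class_eq rb_eq.rota_baxter rangeI)+

primrec rb_eval :: "('b, 'm) monoid_scheme \<Rightarrow> ('b \<Rightarrow> 'b) \<Rightarrow> ('a \<Rightarrow> 'b) \<Rightarrow> 'a rb_term \<Rightarrow> 'b" where
  "rb_eval H C f (Gen x) = f x"
| "rb_eval H C f One = \<one>\<^bsub>H\<^esub>"
| "rb_eval H C f (Mul s t) = rb_eval H C f s \<otimes>\<^bsub>H\<^esub> rb_eval H C f t"
| "rb_eval H C f (Inv s) = inv\<^bsub>H\<^esub> (rb_eval H C f s)"
| "rb_eval H C f (Op s) = C (rb_eval H C f s)"

context rota_baxter_group
begin

lemma rb_eval_closed [simp]:
  assumes "range f \<subseteq> carrier G"
  shows "rb_eval G B f t \<in> carrier G"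
  using assms by (induction t) auto

lemma rb_eval_eq:
  assumes "range f \<subseteq> carrier G" "rb_eq s t"
  shows "rb_eval G B f s = rb_eval G B f t"
  using assms(2)
  by (induction rule: rb_eq.induct) (simp_all add: assms(1) m_assoc op_mult[symmetric] op_mult)

lemma rb_eval_rep:
  assumes "range f \<subseteq> carrier G"
  shows "rb_eval G B f (rb_rep (rb_class t)) = rb_eval G B f t"
  using rb_eval_eq[OF assms rb_rep_class] .

lemma rb_eval_hom:
  assumes "range f \<subseteq> carrier G"
  shows "(\<lambda>c. rb_eval G B f (rb_rep c)) \<in> rota_baxter_hom rb_quot rb_quot_op G B"
  using assms
  by (auto simp: rota_baxter_hom_def hom_def rb_quot_simps rb_eval_rep)

end

lemma rota_baxter_hom_comp:
  assumes "\<phi> \<in> rota_baxter_hom G B H C" "\<psi> \<in> rota_baxter_hom H C K D"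
  shows "(\<lambda>x. \<psi> (\<phi> x)) \<in> rota_baxter_hom G B K D"
  using assms by (auto simp: rota_baxter_hom_def hom_def Pi_iff)

lemma rb_eval_hom_image:
  assumes "rota_baxter_group G B" "rota_baxter_group H C" "range f \<subseteq> carrier G"
    "\<phi> \<in> rota_baxter_hom G B H C"
  shows "\<phi> (rb_eval G B f t) = rb_eval H C (\<lambda>x. \<phi> (f x)) t"
proof -
  interpret G: rota_baxter_group G B by fact
  interpret H: rota_baxter_group H C by fact
  have "\<phi> \<in> hom G H" using assms(4) by (simp add: rota_baxter_hom_def)
  then interpret group_hom G H \<phi>
    by (intro group_hom.intro group_hom_axioms.intro) (auto simp: G.is_group H.is_group)
  show ?thesis
    using assms(3,4) by (induction t) (auto simp: rota_baxter_hom_def)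
qed

text \<open>Any Rota--Baxter group on \<open>'a\<close> has an isomorphic copy on \<open>'a rb_term set\<close>.\<close>

lemma rota_baxter_copy:
  assumes "rota_baxter_group G B"
  obtains H :: "'a rb_term set monoid" and C
  where "rota_baxter_group H C" "(\<lambda>g::'a. {Gen g}) \<in> rota_baxter_hom G B H C"
proof -
  interpret rota_baxter_group G B by fact
  define e where "e = (\<lambda>g::'a. {Gen g})"
  define d where "d = inv_into UNIV e"
  have de [simp]: "d (e g) = g" for g
    unfolding d_def by (rule inv_f_f) (auto simp: e_def inj_on_def)
  define H where "H = \<lparr>carrier = e ` carrier G, mult = (\<lambda>a b. e (d a \<otimes>\<^bsub>G\<^esub> d b)), one = e \<one>\<^bsub>G\<^esub>\<rparr>"
  define C where "C = (\<lambda>a. e (B (d a)))"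
  have grp: "group H"
  proof (rule groupI)
    fix x assume "x \<in> carrier H"
    then show "\<exists>y\<in>carrier H. y \<otimes>\<^bsub>H\<^esub> x = \<one>\<^bsub>H\<^esub>"
      by (intro bexI[of _ "e (inv\<^bsub>G\<^esub> (d x))"]) (auto simp: H_def)
  qed (auto simp: H_def m_assoc)
  have inv: "inv\<^bsub>H\<^esub> (e g) = e (inv\<^bsub>G\<^esub> g)" if "g \<in> carrier G" for g
    by (rule group.inv_equality[OF grp]) (use that in \<open>auto simp: H_def\<close>)
  have "rota_baxter_group H C"
  proof (intro rota_baxter_group.intro grp rota_baxter_group_axioms.intro)
    fix g h assume "g \<in> carrier H" "h \<in> carrier H"
    then obtain g' h' where gh: "g = e g'" "h = e h'" "g' \<in> carrier G" "h' \<in> carrier G"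
      by (auto simp: H_def)
    have "inv\<^bsub>H\<^esub> C g = e (inv\<^bsub>G\<^esub> B g')"
      using gh inv[of "B g'"] by (simp add: C_def)
    then show "C g \<otimes>\<^bsub>H\<^esub> C h = C (g \<otimes>\<^bsub>H\<^esub> C g \<otimes>\<^bsub>H\<^esub> h \<otimes>\<^bsub>H\<^esub> inv\<^bsub>H\<^esub> C g)"
      using gh by (simp add: H_def C_def op_mult)
  qed (auto simp: H_def C_def)
  moreover have "e \<in> rota_baxter_hom G B H C"
    by (auto simp: rota_baxter_hom_def hom_def H_def C_def)
  ultimately show ?thesis
    using that by (simp add: e_def)
qed

theorem free_rota_baxter_group_all_types:
  fixes G :: "('a, 'm) monoid_scheme"
  assumes "free_rota_baxter_group TYPE('a rb_term set) G B X"
  shows "free_rota_baxter_group TYPE('b) G B X"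
proof -
  have rb: "rota_baxter_group G B" and X: "X \<subseteq> carrier G"
    and univ: "\<And>(H :: 'a rb_term set monoid) C f. rota_baxter_group H C \<Longrightarrow> f \<in> X \<rightarrow> carrier H \<Longrightarrow>
      (\<exists>!\<phi>. \<phi> \<in> rota_baxter_hom G B H C \<inter> extensional (carrier G) \<and> (\<forall>x\<in>X. \<phi> x = f x))"
    using assms unfolding free_rota_baxter_group_def by blast+
  interpret G: rota_baxter_group G B by fact
  have unique: "h g = k g"
    if "rota_baxter_group H C" and h: "h \<in> rota_baxter_hom G B H C"
      and k: "k \<in> rota_baxter_hom G B H C" and eq: "\<And>x. x \<in> X \<Longrightarrow> h x = k x"
      and g: "g \<in> carrier G"
    for H :: "'a rb_term set monoid" and C h k g
  proof -
    have r: "restrict l (carrier G) \<in> rota_baxter_hom G B H C \<inter> extensional (carrier G)"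
      if "l \<in> rota_baxter_hom G B H C" for l
      using that by (auto simp: rota_baxter_hom_def hom_def)
    have "h \<in> X \<rightarrow> carrier H"
      using h X by (auto simp: rota_baxter_hom_def hom_def)
    from univ[OF that(1) this] have "restrict h (carrier G) = restrict k (carrier G)"
      using r[OF h] r[OF k] eq X by (metis (no_types, lifting) restrict_apply' subsetD)
    then show ?thesis using g by (metis restrict_apply')
  qed
  have "(\<lambda>x. rb_class (Gen x)) \<in> X \<rightarrow> carrier rb_quot"
    by (auto simp: rb_quot_simps)
  from univ[OF rota_baxter_rb_quot this]
  obtain \<phi> where \<phi>: "\<phi> \<in> rota_baxter_hom G B rb_quot rb_quot_op"
    and \<phi>X: "\<And>x. x \<in> X \<Longrightarrow> \<phi> x = rb_class (Gen x)"
    by blast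
  define i where "i = (\<lambda>x. if x \<in> X then x else \<one>\<^bsub>G\<^esub>)"
  have i: "range i \<subseteq> carrier G" using X by (auto simp: i_def)
  define \<psi> where "\<psi> = (\<lambda>c. rb_eval G B i (rb_rep c))"
  have \<psi>: "\<psi> \<in> rota_baxter_hom rb_quot rb_quot_op G B"
    unfolding \<psi>_def by (rule G.rb_eval_hom[OF i])
  have \<psi>\<phi>X: "\<psi> (\<phi> x) = x" if "x \<in> X" for x
    using that G.rb_eval_rep[OF i, of "Gen x"] by (simp add: \<phi>X \<psi>_def) (simp add: i_def)
  have \<psi>\<phi>: "\<psi> (\<phi> g) = g" if g: "g \<in> carrier G" for g
  proof -
    obtain H :: "'a rb_term set monoid" and C
      where H: "rota_baxter_group H C" and e: "(\<lambda>g. {Gen g}) \<in> rota_baxter_hom G B H C"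
      using rota_baxter_copy[OF rb] by blast
    have "{Gen (\<psi> (\<phi> g))} = {Gen g}"
      by (rule unique[OF H _ e _ g])
        (use rota_baxter_hom_comp[OF rota_baxter_hom_comp[OF \<phi> \<psi>] e] in
          \<open>auto simp: \<psi>\<phi>X\<close>)
    then show ?thesis by simp
  qed
  show ?thesis
    unfolding free_rota_baxter_group_def
  proof (intro conjI rb X allI impI ex_ex1I)
    fix H :: "'b monoid" and C f
    assume *: "rota_baxter_group H C \<and> f \<in> X \<rightarrow> carrier H"
    then interpret H: rota_baxter_group H C by simp
    define f' where "f' = (\<lambda>x. if x \<in> X then f x else \<one>\<^bsub>H\<^esub>)"
    have f': "range f' \<subseteq> carrier H" using * by (auto simp: f'_def)
    define \<theta> where "\<theta> = (\<lambda>g. rb_eval H C f' (rb_rep (\<phi> g)))"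
    have \<theta>: "\<theta> \<in> rota_baxter_hom G B H C"
      unfolding \<theta>_def by (rule rota_baxter_hom_comp[OF \<phi> H.rb_eval_hom[OF f']])
    have "\<theta> x = f x" if "x \<in> X" for x
      using that H.rb_eval_rep[OF f', of "Gen x"]
      by (simp add: \<theta>_def \<phi>X) (simp add: f'_def)
    then show "\<exists>\<theta>. \<theta> \<in> rota_baxter_hom G B H C \<inter> extensional (carrier G) \<and> (\<forall>x\<in>X. \<theta> x = f x)"
      using \<theta> X
      by (intro exI[of _ "restrict \<theta> (carrier G)"]) (auto simp: rota_baxter_hom_def hom_def)
  next
    fix H :: "'b monoid" and C f h k
    assume *: "rota_baxter_group H C \<and> f \<in> X \<rightarrow> carrier H"
      and h: "h \<in> rota_baxter_hom G B H C \<inter> extensional (carrier G) \<and> (\<forall>x\<in>X. h x = f x)"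
      and k: "k \<in> rota_baxter_hom G B H C \<inter> extensional (carrier G) \<and> (\<forall>x\<in>X. k x = f x)"
    interpret H: rota_baxter_group H C using * by simp
    have one: "l \<one>\<^bsub>G\<^esub> = \<one>\<^bsub>H\<^esub>" if "l \<in> rota_baxter_hom G B H C" for l
      using that hom_one[OF _ G.is_group H.is_group] by (auto simp: rota_baxter_hom_def)
    have hk: "(\<lambda>x. h (i x)) = (\<lambda>x. k (i x))"
      using h k one[of h] one[of k] by (auto simp: i_def)
    have "h g = k g" if g: "g \<in> carrier G" for g
    proof -
      have "h (\<psi> (\<phi> g)) = k (\<psi> (\<phi> g))"
        using h k rb_eval_hom_image[OF rb H.rota_baxter_group_axioms i, of h]
          rb_eval_hom_image[OF rb H.rota_baxter_group_axioms i, of k]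
        by (simp add: \<psi>_def hk)
      then show ?thesis by (simp add: \<psi>\<phi>[OF g])
    qed
    then show "h = k"
      using h k by (auto intro: extensionalityI)
  qed
qed

end

theory Submission
  imports Defs
begin

text \<open>
  The point is that every skew left brace \<open>(A, \<cdot>, \<circ>)\<close> sits inside the brace of some
  Rota--Baxter group. Write \<open>a \<circ> b = a \<cdot> \<lambda>\<^sub>a(b)\<close>; then \<open>\<lambda>\<close> is an action of \<open>(A, \<circ>)\<close> on
  \<open>(A, \<cdot>)\<close> by automorphisms, and the semidirect product \<open>P = (A, \<cdot>) \<rtimes> (A, \<circ>)\<close> factorizes
  uniquely as \<open>P = D L\<close>, where \<open>D\<close> is the diagonal, a subgroup because
  \<open>(a, a) (b, b) = (a \<cdot> \<lambda>\<^sub>a(b), a \<circ> b)\<close>, and \<open>L = {1} \<times> A\<close>. Sending \<open>d l\<close> to \<open>l\<inverse>\<close> is a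
  Rota--Baxter operator \<open>B\<close> on any group with such a factorization: for \<open>g = d l\<close> and
  \<open>h = d' l'\<close> one gets \<open>g B(g) h B(g)\<inverse> = d d' l' l\<close>, which \<open>B\<close> sends to
  \<open>l\<inverse> l'\<inverse> = B(g) B(h)\<close>. Here \<open>B\<close> sends \<open>(a, 1)\<close> to
  \<open>(1, a)\<close>, and conjugation by \<open>(1, a)\<close> acts on \<open>A \<times> {1}\<close> as \<open>\<lambda>\<^sub>a\<close>, so that \<open>a \<mapsto> (a, 1)\<close>
  embeds the given brace into the brace of \<open>P\<close>.

  Existence: a map \<open>f\<close> from \<open>X\<close> to \<open>A\<close> gives \<open>x \<mapsto> (f x, 1)\<close>, which the freeness of \<open>G\<close> extends
  to a Rota--Baxter homomorphism \<open>\<phi>\<close> from \<open>G\<close> to \<open>P\<close>. It is a brace homomorphism too, so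
  the preimage of \<open>A \<times> {1}\<close> is a subbrace containing \<open>X\<close>, hence contains the subbrace \<open>S\<close>
  generated by \<open>X\<close>, and the first component of \<open>\<phi>\<close> on \<open>S\<close> is the homomorphism sought.
  Uniqueness: the elements of \<open>S\<close> on which two homomorphisms agree form a subbrace; if it
  contains \<open>X\<close>, it is all of \<open>S\<close>.
\<close>

section \<open>Subbraces\<close>

lemma (in group_hom) subgroup_preimage:
  assumes "subgroup K H"
  shows "subgroup {x \<in> carrier G. h x \<in> K} G"
proof -
  interpret K: subgroup K H by fact
  show ?thesis
    by (rule G.subgroupI) (auto intro!: exI[of _ "\<one>"])
qed

lemma subgroup_equalizer:
  assumes "group_hom G H h" "group_hom G H k"
  shows "subgroup {x \<in> carrier G. h x = k x} G"
proof -
  interpret h: group_hom G H h by fact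
  interpret k: group_hom G H k by fact
  show ?thesis
    by (rule h.G.subgroupI) (auto intro!: exI[of _ "\<one>\<^bsub>G\<^esub>"])
qed

text \<open>An equational class is closed under substructures; only the inverse has to be compared.\<close>

lemma (in skew_left_brace) skew_left_brace_subbrace:
  assumes "skew_left_subbrace S A C"
  shows "skew_left_brace (A\<lparr>carrier := S\<rparr>) (C\<lparr>carrier := S\<rparr>)"
proof -
  have S: "subgroup S A" "subgroup S C"
    using assms by (simp_all add: skew_left_subbrace_def)
  show ?thesis
  proof (intro skew_left_brace.intro skew_left_brace_axioms.intro)
    fix a b c assume "a \<in> carrier (A\<lparr>carrier := S\<rparr>)" "b \<in> carrier (A\<lparr>carrier := S\<rparr>)"
      "c \<in> carrier (A\<lparr>carrier := S\<rparr>)"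
    then show "a \<otimes>\<^bsub>C\<lparr>carrier := S\<rparr>\<^esub> (b \<otimes>\<^bsub>A\<lparr>carrier := S\<rparr>\<^esub> c)
        = a \<otimes>\<^bsub>C\<lparr>carrier := S\<rparr>\<^esub> b \<otimes>\<^bsub>A\<lparr>carrier := S\<rparr>\<^esub> inv\<^bsub>A\<lparr>carrier := S\<rparr>\<^esub> a
          \<otimes>\<^bsub>A\<lparr>carrier := S\<rparr>\<^esub> (a \<otimes>\<^bsub>C\<lparr>carrier := S\<rparr>\<^esub> c)"
      using subgroup.subset[OF S(1)]
      by (auto simp: A.m_inv_consistent[OF S(1)] intro!: compat)
  qed (use S in \<open>simp_all add: A.subgroup_imp_group C.subgroup_imp_group\<close>)
qed

lemma (in skew_left_brace) skew_left_subbrace_generated_subbrace: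
  assumes "X \<subseteq> carrier A"
  shows "skew_left_subbrace (skew_left_subbrace_generated A C X) A C"
proof -
  have "skew_left_subbrace (carrier A) A C"
    using A.subgroup_self C.subgroup_self carrier_eq by (simp add: skew_left_subbrace_def)
  then have "{S. skew_left_subbrace S A C \<and> X \<subseteq> S} \<noteq> {}"
    using assms by blast
  then show ?thesis
    unfolding skew_left_subbrace_generated_def
    by (subst skew_left_subbrace_def)
      (auto simp: skew_left_subbrace_def intro!: A.subgroups_Inter C.subgroups_Inter)
qed

lemma skew_left_subbrace_generated_superset: "X \<subseteq> skew_left_subbrace_generated A C X"
  by (auto simp: skew_left_subbrace_generated_def)

lemma skew_left_subbrace_generated_least:
  assumes "skew_left_subbrace S A C" "X \<subseteq> S"
  shows "skew_left_subbrace_generated A C X \<subseteq> S"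
  using assms by (auto simp: skew_left_subbrace_generated_def)

text \<open>
  A subgroup of the two restricted groups is a subgroup of the ambient ones, so the subbrace on
  which two homomorphisms agree already contains all that \<open>X\<close> generates in the ambient brace.
\<close>

lemma (in skew_left_brace) skew_left_brace_hom_unique:
  fixes X
  defines "S \<equiv> skew_left_subbrace_generated A C X"
  assumes X: "X \<subseteq> carrier A"
    and D: "skew_left_brace A' C'"
    and h: "h \<in> skew_left_brace_hom (A\<lparr>carrier := S\<rparr>) (C\<lparr>carrier := S\<rparr>) A' C'"
    and k: "k \<in> skew_left_brace_hom (A\<lparr>carrier := S\<rparr>) (C\<lparr>carrier := S\<rparr>) A' C'"
    and eq: "\<And>x. x \<in> X \<Longrightarrow> h x = k x"
    and x: "x \<in> S"
  shows "h x = k x"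
proof -
  interpret D: skew_left_brace A' C' by fact
  have S: "subgroup S A" "subgroup S C"
    using skew_left_subbrace_generated_subbrace[OF X] by (simp_all add: S_def skew_left_subbrace_def)
  let ?E = "{x \<in> S. h x = k x}"
  have "subgroup {x \<in> carrier (A\<lparr>carrier := S\<rparr>). h x = k x} (A\<lparr>carrier := S\<rparr>)"
    by (rule subgroup_equalizer[where H = A'])
      (use h k S in \<open>auto simp: skew_left_brace_hom_def group_hom_def group_hom_axioms_def
         A.subgroup_imp_group D.A.is_group\<close>)
  then have "subgroup ?E A"
    using A.incl_subgroup[OF S(1)] by simp
  moreover have "subgroup {x \<in> carrier (C\<lparr>carrier := S\<rparr>). h x = k x} (C\<lparr>carrier := S\<rparr>)"
    by (rule subgroup_equalizer[where H = C'])
      (use h k S in \<open>auto simp: skew_left_brace_hom_def group_hom_def group_hom_axioms_def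
         C.subgroup_imp_group D.C.is_group\<close>)
  then have "subgroup ?E C"
    using C.incl_subgroup[OF S(2)] by simp
  moreover have "X \<subseteq> ?E"
    using eq skew_left_subbrace_generated_superset[of X A C] by (auto simp: S_def)
  ultimately have "S \<subseteq> ?E"
    unfolding S_def by (intro skew_left_subbrace_generated_least) (simp_all add: skew_left_subbrace_def)
  then show ?thesis using x by blast
qed

section \<open>Rota--Baxter homomorphisms are brace homomorphisms\<close>

lemma rota_baxter_hom_circ_hom:
  assumes "rota_baxter_group G B" "rota_baxter_group H C" "\<phi> \<in> rota_baxter_hom G B H C"
  shows "\<phi> \<in> skew_left_brace_hom G (circ_group G B) H (circ_group H C)"
proof -
  interpret G: rota_baxter_group G B by fact
  interpret H: rota_baxter_group H C by fact
  interpret group_hom G H \<phi>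
    using assms(3) by unfold_locales (simp add: rota_baxter_hom_def)
  show ?thesis
    using assms(3)
    by (auto simp: skew_left_brace_hom_def rota_baxter_hom_def circ_group_def hom_def)
qed

section \<open>The Rota--Baxter group of a skew left brace\<close>

context skew_left_brace
begin

lemma C_closed [simp]:
  "a \<in> carrier A \<Longrightarrow> b \<in> carrier A \<Longrightarrow> a \<otimes>\<^bsub>C\<^esub> b \<in> carrier A"
  "a \<in> carrier A \<Longrightarrow> inv\<^bsub>C\<^esub> a \<in> carrier A"
  using C.m_closed C.inv_closed by (simp_all add: carrier_eq)

text \<open>Distributivity with the unit of \<open>C\<close> on the left and the unit of \<open>A\<close> on the right.\<close>

lemma one_eq: "\<one>\<^bsub>C\<^esub> = \<one>\<^bsub>A\<^esub>"
proof -
  have C1: "\<one>\<^bsub>C\<^esub> \<in> carrier A" using C.one_closed by (simp add: carrier_eq)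
  have "\<one>\<^bsub>C\<^esub> \<otimes>\<^bsub>C\<^esub> \<one>\<^bsub>A\<^esub> = \<one>\<^bsub>A\<^esub>" by (simp add: carrier_eq)
  then have "\<one>\<^bsub>A\<^esub> = inv\<^bsub>A\<^esub> \<one>\<^bsub>C\<^esub>"
    using compat[OF C1 A.one_closed A.one_closed] C1 by simp
  then show ?thesis using C1 by (metis A.inv_inv A.inv_one)
qed

lemma C_simps [simp]:
  assumes "a \<in> carrier A" "b \<in> carrier A"
  shows "\<one>\<^bsub>A\<^esub> \<otimes>\<^bsub>C\<^esub> a = a" "a \<otimes>\<^bsub>C\<^esub> \<one>\<^bsub>A\<^esub> = a"
    "a \<otimes>\<^bsub>C\<^esub> inv\<^bsub>C\<^esub> a = \<one>\<^bsub>A\<^esub>" "inv\<^bsub>C\<^esub> a \<otimes>\<^bsub>C\<^esub> a = \<one>\<^bsub>A\<^esub>"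
    "a \<otimes>\<^bsub>C\<^esub> (inv\<^bsub>C\<^esub> a \<otimes>\<^bsub>C\<^esub> b) = b" "inv\<^bsub>C\<^esub> a \<otimes>\<^bsub>C\<^esub> (a \<otimes>\<^bsub>C\<^esub> b) = b"
    "inv\<^bsub>C\<^esub> (inv\<^bsub>C\<^esub> a) = a" "inv\<^bsub>C\<^esub> (a \<otimes>\<^bsub>C\<^esub> b) = inv\<^bsub>C\<^esub> b \<otimes>\<^bsub>C\<^esub> inv\<^bsub>C\<^esub> a"
  using assms by (simp_all add: one_eq[symmetric] carrier_eq[symmetric] C.m_assoc[symmetric]
      C.inv_mult_group)

lemma C_one_inv [simp]: "inv\<^bsub>C\<^esub> \<one>\<^bsub>A\<^esub> = \<one>\<^bsub>A\<^esub>"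
  using C.inv_one by (simp add: one_eq)

lemma C_assoc:
  "a \<in> carrier A \<Longrightarrow> b \<in> carrier A \<Longrightarrow> c \<in> carrier A \<Longrightarrow>
    (a \<otimes>\<^bsub>C\<^esub> b) \<otimes>\<^bsub>C\<^esub> c = a \<otimes>\<^bsub>C\<^esub> (b \<otimes>\<^bsub>C\<^esub> c)"
  by (simp add: C.m_assoc carrier_eq)

text \<open>This is \<open>\<lambda>\<^sub>a(b)\<close>.\<close>

definition act :: "'a \<Rightarrow> 'a \<Rightarrow> 'a"
  where "act a b = inv\<^bsub>A\<^esub> a \<otimes>\<^bsub>A\<^esub> (a \<otimes>\<^bsub>C\<^esub> b)"

lemma act_closed [simp]: "a \<in> carrier A \<Longrightarrow> b \<in> carrier A \<Longrightarrow> act a b \<in> carrier A"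
  by (simp add: act_def)

lemma mult_act: "a \<in> carrier A \<Longrightarrow> b \<in> carrier A \<Longrightarrow> a \<otimes>\<^bsub>A\<^esub> act a b = a \<otimes>\<^bsub>C\<^esub> b"
  by (simp add: act_def A.m_assoc[symmetric])

lemma act_one [simp]: "a \<in> carrier A \<Longrightarrow> act \<one>\<^bsub>A\<^esub> a = a" "a \<in> carrier A \<Longrightarrow> act a \<one>\<^bsub>A\<^esub> = \<one>\<^bsub>A\<^esub>"
  by (simp_all add: act_def)

lemma act_mult:
  "a \<in> carrier A \<Longrightarrow> b \<in> carrier A \<Longrightarrow> c \<in> carrier A \<Longrightarrow>
    act a (b \<otimes>\<^bsub>A\<^esub> c) = act a b \<otimes>\<^bsub>A\<^esub> act a c"
  by (simp add: act_def compat A.m_assoc)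

text \<open>Apply \<open>\<lambda>\<^sub>a\<close> to \<open>b \<circ> c = b \<cdot> \<lambda>\<^sub>b(c)\<close>, multiply by \<open>a\<close> and cancel \<open>a \<circ> b\<close>.\<close>

lemma act_circ:
  assumes "a \<in> carrier A" "b \<in> carrier A" "c \<in> carrier A"
  shows "act (a \<otimes>\<^bsub>C\<^esub> b) c = act a (act b c)"
proof -
  have "(a \<otimes>\<^bsub>C\<^esub> b) \<otimes>\<^bsub>A\<^esub> act a (act b c) = a \<otimes>\<^bsub>A\<^esub> act a (b \<otimes>\<^bsub>A\<^esub> act b c)"
    using assms by (simp add: mult_act[symmetric, of a b] act_mult A.m_assoc)
  also have "\<dots> = (a \<otimes>\<^bsub>C\<^esub> b) \<otimes>\<^bsub>A\<^esub> act (a \<otimes>\<^bsub>C\<^esub> b) c"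
    using assms by (simp add: mult_act C_assoc)
  finally show ?thesis using assms by simp
qed

definition semidirect :: "('a \<times> 'a) monoid"
  where "semidirect = \<lparr>carrier = carrier A \<times> carrier A,
    mult = (\<lambda>(a, c) (b, d). (a \<otimes>\<^bsub>A\<^esub> act c b, c \<otimes>\<^bsub>C\<^esub> d)),
    one = (\<one>\<^bsub>A\<^esub>, \<one>\<^bsub>A\<^esub>)\<rparr>"

text \<open>
  This is \<open>d l \<mapsto> l\<inverse>\<close> for the factorization
  \<open>(a, c) = (a, a) (1, a' \<circ> c)\<close>, with \<open>a'\<close> the inverse of \<open>a\<close> for \<open>\<circ>\<close>.
\<close>

definition semidirect_op :: "'a \<times> 'a \<Rightarrow> 'a \<times> 'a"
  where "semidirect_op = (\<lambda>(a, c). (\<one>\<^bsub>A\<^esub>, inv\<^bsub>C\<^esub> c \<otimes>\<^bsub>C\<^esub> a))"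

lemma semidirect_simps [simp]:
  "carrier semidirect = carrier A \<times> carrier A"
  "(a, c) \<otimes>\<^bsub>semidirect\<^esub> (b, d) = (a \<otimes>\<^bsub>A\<^esub> act c b, c \<otimes>\<^bsub>C\<^esub> d)"
  "\<one>\<^bsub>semidirect\<^esub> = (\<one>\<^bsub>A\<^esub>, \<one>\<^bsub>A\<^esub>)"
  "semidirect_op (a, c) = (\<one>\<^bsub>A\<^esub>, inv\<^bsub>C\<^esub> c \<otimes>\<^bsub>C\<^esub> a)"
  by (simp_all add: semidirect_def semidirect_op_def)

lemma group_semidirect: "group semidirect"
proof (rule groupI)
  fix x assume "x \<in> carrier semidirect"
  then obtain a c where x: "x = (a, c)" "a \<in> carrier A" "c \<in> carrier A" by auto
  have "act (inv\<^bsub>C\<^esub> c) (inv\<^bsub>A\<^esub> a) \<otimes>\<^bsub>A\<^esub> act (inv\<^bsub>C\<^esub> c) a = \<one>\<^bsub>A\<^esub>"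
    using x by (simp add: act_mult[symmetric])
  then show "\<exists>y\<in>carrier semidirect. y \<otimes>\<^bsub>semidirect\<^esub> x = \<one>\<^bsub>semidirect\<^esub>"
    using x by (intro bexI[of _ "(act (inv\<^bsub>C\<^esub> c) (inv\<^bsub>A\<^esub> a), inv\<^bsub>C\<^esub> c)"]) simp_all
qed (auto simp: act_mult act_circ A.m_assoc C_assoc)

lemma inv_semidirect_right:
  assumes "c \<in> carrier A"
  shows "inv\<^bsub>semidirect\<^esub> (\<one>\<^bsub>A\<^esub>, c) = (\<one>\<^bsub>A\<^esub>, inv\<^bsub>C\<^esub> c)"
  by (rule group.inv_equality[OF group_semidirect]) (use assms in simp_all)

text \<open>
  Here \<open>(a, c) B(a, c)\<close> is the diagonal factor \<open>(a, a)\<close>, so the product is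
  \<open>(a, a) (b, d) (1, a' \<circ> c)\<close>, whose first component depends on \<open>a\<close> and \<open>b\<close> only.
\<close>

lemma circ_semidirect:
  assumes "a \<in> carrier A" "c \<in> carrier A" "b \<in> carrier A" "d \<in> carrier A"
  shows "(a, c) \<otimes>\<^bsub>semidirect\<^esub> semidirect_op (a, c) \<otimes>\<^bsub>semidirect\<^esub> (b, d)
      \<otimes>\<^bsub>semidirect\<^esub> inv\<^bsub>semidirect\<^esub> semidirect_op (a, c)
    = (a \<otimes>\<^bsub>C\<^esub> b, a \<otimes>\<^bsub>C\<^esub> d \<otimes>\<^bsub>C\<^esub> inv\<^bsub>C\<^esub> a \<otimes>\<^bsub>C\<^esub> c)"
  using assms by (simp add: inv_semidirect_right mult_act C_assoc)

lemma rota_baxter_semidirect: "rota_baxter_group semidirect semidirect_op"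
proof (intro rota_baxter_group.intro group_semidirect rota_baxter_group_axioms.intro)
  fix g h assume "g \<in> carrier semidirect" "h \<in> carrier semidirect"
  then obtain a c b d where "g = (a, c)" "h = (b, d)"
    "a \<in> carrier A" "c \<in> carrier A" "b \<in> carrier A" "d \<in> carrier A" by auto
  then show "semidirect_op g \<otimes>\<^bsub>semidirect\<^esub> semidirect_op h
      = semidirect_op (g \<otimes>\<^bsub>semidirect\<^esub> semidirect_op g \<otimes>\<^bsub>semidirect\<^esub> h
          \<otimes>\<^bsub>semidirect\<^esub> inv\<^bsub>semidirect\<^esub> semidirect_op g)"
    by (simp only: circ_semidirect) (simp add: C_assoc)
qed auto

abbreviation semidirect_circ :: "('a \<times> 'a) monoid"
  where "semidirect_circ \<equiv> circ_group semidirect semidirect_op"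

text \<open>
  On \<open>A \<times> {1}\<close> both products are those of the first components: \<open>\<lambda>\<close> of the unit is trivial,
  and the second component of a \<open>\<circ>\<close>-product is \<open>a \<circ> 1 \<circ> a' \<circ> 1 = 1\<close>.
\<close>

lemma left_factor_mult:
  assumes "a \<in> carrier A" "b \<in> carrier A"
  shows "(a, \<one>\<^bsub>A\<^esub>) \<otimes>\<^bsub>semidirect\<^esub> (b, \<one>\<^bsub>A\<^esub>) = (a \<otimes>\<^bsub>A\<^esub> b, \<one>\<^bsub>A\<^esub>)"
    and "(a, \<one>\<^bsub>A\<^esub>) \<otimes>\<^bsub>semidirect_circ\<^esub> (b, \<one>\<^bsub>A\<^esub>) = (a \<otimes>\<^bsub>C\<^esub> b, \<one>\<^bsub>A\<^esub>)"
proof -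
  show "(a, \<one>\<^bsub>A\<^esub>) \<otimes>\<^bsub>semidirect\<^esub> (b, \<one>\<^bsub>A\<^esub>) = (a \<otimes>\<^bsub>A\<^esub> b, \<one>\<^bsub>A\<^esub>)"
    using assms by simp
  show "(a, \<one>\<^bsub>A\<^esub>) \<otimes>\<^bsub>semidirect_circ\<^esub> (b, \<one>\<^bsub>A\<^esub>) = (a \<otimes>\<^bsub>C\<^esub> b, \<one>\<^bsub>A\<^esub>)"
    using circ_semidirect[of a "\<one>\<^bsub>A\<^esub>" b "\<one>\<^bsub>A\<^esub>"] assms by (simp add: circ_group_def)
qed

lemma left_factor_subbrace:
  "skew_left_subbrace (carrier A \<times> {\<one>\<^bsub>A\<^esub>}) semidirect semidirect_circ"
proof -
  interpret P: skew_left_brace semidirect semidirect_circ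
    by (rule rota_baxter_group.skew_left_brace_circ_group[OF rota_baxter_semidirect])
  have inv: "inv\<^bsub>semidirect\<^esub> (a, \<one>\<^bsub>A\<^esub>) = (inv\<^bsub>A\<^esub> a, \<one>\<^bsub>A\<^esub>)"
    "inv\<^bsub>semidirect_circ\<^esub> (a, \<one>\<^bsub>A\<^esub>) = (inv\<^bsub>C\<^esub> a, \<one>\<^bsub>A\<^esub>)" if "a \<in> carrier A" for a
    by (rule P.A.inv_equality P.C.inv_equality;
        use that in \<open>simp add: left_factor_mult P.one_eq P.carrier_eq del: semidirect_simps(2)\<close>)+
  show ?thesis
    unfolding skew_left_subbrace_def
    by (intro conjI P.A.subgroupI P.C.subgroupI)
      (auto simp: inv left_factor_mult P.carrier_eq simp del: semidirect_simps(2))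
qed

end

section \<open>The universal property\<close>

theorem proposition3p14:
  fixes G :: "('a, 'm) monoid_scheme" and B :: "'a \<Rightarrow> 'a" and X :: "'a set"
  assumes "free_rota_baxter_group TYPE('a rb_term set) G B X"
  defines "S \<equiv> skew_left_subbrace_generated G (circ_group G B) X"
  shows "free_skew_left_brace TYPE('b) (G\<lparr>carrier := S\<rparr>) ((circ_group G B)\<lparr>carrier := S\<rparr>) X"
proof -
  \<comment> \<open>The target of the embedding is carried by pairs over \<open>'b\<close>.\<close>
  have free: "free_rota_baxter_group TYPE('b \<times> 'b) G B X"
    by (rule free_rota_baxter_group_all_types[OF assms(1)])
  then have rb: "rota_baxter_group G B" and X: "X \<subseteq> carrier G"
    and extend: "\<And>(H :: ('b \<times> 'b) monoid) C f. rota_baxter_group H C \<Longrightarrow> f \<in> X \<rightarrow> carrier H \<Longrightarrow>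
      \<exists>\<phi>. \<phi> \<in> rota_baxter_hom G B H C \<and> (\<forall>x\<in>X. \<phi> x = f x)"
    unfolding free_rota_baxter_group_def by blast+
  let ?C = "circ_group G B"
  interpret G: skew_left_brace G ?C
    by (rule rota_baxter_group.skew_left_brace_circ_group[OF rb])
  have S: "skew_left_subbrace S G ?C"
    unfolding S_def by (rule G.skew_left_subbrace_generated_subbrace[OF X])
  have XS: "X \<subseteq> S"
    unfolding S_def by (rule skew_left_subbrace_generated_superset)
  have closed: "x \<otimes>\<^bsub>G\<^esub> y \<in> S" "x \<otimes>\<^bsub>?C\<^esub> y \<in> S" "x \<in> carrier G" if "x \<in> S" "y \<in> S" for x y
    using S that unfolding skew_left_subbrace_def
    by (auto intro: subgroup.m_closed subgroup.mem_carrier)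
  show ?thesis
    unfolding free_skew_left_brace_def
  proof (intro conjI allI impI ex_ex1I)
    show "skew_left_brace (G\<lparr>carrier := S\<rparr>) (?C\<lparr>carrier := S\<rparr>)"
      by (rule G.skew_left_brace_subbrace[OF S])
    show "X \<subseteq> carrier (G\<lparr>carrier := S\<rparr>)"
      using XS by simp
  next
    fix A' C' :: "'b monoid" and f
    assume *: "skew_left_brace A' C' \<and> f \<in> X \<rightarrow> carrier A'"
    then interpret A: skew_left_brace A' C' by simp
    interpret P: skew_left_brace A.semidirect A.semidirect_circ
      by (rule rota_baxter_group.skew_left_brace_circ_group[OF A.rota_baxter_semidirect])
    have "(\<lambda>x. (f x, \<one>\<^bsub>A'\<^esub>)) \<in> X \<rightarrow> carrier A.semidirect"
      using * by auto
    from extend[OF A.rota_baxter_semidirect this]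
    obtain \<phi> where \<phi>: "\<phi> \<in> rota_baxter_hom G B A.semidirect A.semidirect_op"
      and \<phi>X: "\<And>x. x \<in> X \<Longrightarrow> \<phi> x = (f x, \<one>\<^bsub>A'\<^esub>)"
      by blast
    have hom: "\<phi> \<in> hom G A.semidirect" "\<phi> \<in> hom ?C A.semidirect_circ"
      using rota_baxter_hom_circ_hom[OF rb A.rota_baxter_semidirect \<phi>]
      by (simp_all add: skew_left_brace_hom_def)
    interpret hA: group_hom G A.semidirect \<phi>
      by unfold_locales (rule hom)
    interpret hC: group_hom ?C A.semidirect_circ \<phi>
      by unfold_locales (rule hom)
    let ?L = "carrier A' \<times> {\<one>\<^bsub>A'\<^esub>}"
    have "skew_left_subbrace {x \<in> carrier G. \<phi> x \<in> ?L} G ?C"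
      using A.left_factor_subbrace hA.subgroup_preimage[of ?L] hC.subgroup_preimage[of ?L]
      by (simp add: skew_left_subbrace_def G.carrier_eq)
    then have "S \<subseteq> {x \<in> carrier G. \<phi> x \<in> ?L}"
      unfolding S_def by (rule skew_left_subbrace_generated_least) (use X * \<phi>X in auto)
    then have \<phi>S: "\<phi> x = (fst (\<phi> x), \<one>\<^bsub>A'\<^esub>) \<and> fst (\<phi> x) \<in> carrier A'" if "x \<in> S" for x
      using that by (auto simp: mem_Times_iff prod_eq_iff)
    define \<theta> where "\<theta> = restrict (\<lambda>x. fst (\<phi> x)) S"
    have "\<theta> (x \<otimes>\<^bsub>G\<^esub> y) = \<theta> x \<otimes>\<^bsub>A'\<^esub> \<theta> y" "\<theta> (x \<otimes>\<^bsub>?C\<^esub> y) = \<theta> x \<otimes>\<^bsub>C'\<^esub> \<theta> y"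
      if xy: "x \<in> S" "y \<in> S" for x y
    proof -
      obtain a b where ab: "\<phi> x = (a, \<one>\<^bsub>A'\<^esub>)" "\<phi> y = (b, \<one>\<^bsub>A'\<^esub>)" "a \<in> carrier A'" "b \<in> carrier A'"
        using \<phi>S xy by blast
      have "x \<in> carrier G" "y \<in> carrier G"
        using closed(3) xy by blast+
      then have "\<phi> (x \<otimes>\<^bsub>G\<^esub> y) = (a \<otimes>\<^bsub>A'\<^esub> b, \<one>\<^bsub>A'\<^esub>)" "\<phi> (x \<otimes>\<^bsub>?C\<^esub> y) = (a \<otimes>\<^bsub>C'\<^esub> b, \<one>\<^bsub>A'\<^esub>)"
        using ab A.left_factor_mult[of a b] by (simp_all add: G.carrier_eq)
      then show "\<theta> (x \<otimes>\<^bsub>G\<^esub> y) = \<theta> x \<otimes>\<^bsub>A'\<^esub> \<theta> y" "\<theta> (x \<otimes>\<^bsub>?C\<^esub> y) = \<theta> x \<otimes>\<^bsub>C'\<^esub> \<theta> y"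
        using ab xy closed by (simp_all add: \<theta>_def)
    qed
    then have "\<theta> \<in> skew_left_brace_hom (G\<lparr>carrier := S\<rparr>) (?C\<lparr>carrier := S\<rparr>) A' C'"
      using \<phi>S by (auto simp: skew_left_brace_hom_def hom_def A.carrier_eq \<theta>_def)
    moreover have "\<theta> \<in> extensional S" "\<forall>x\<in>X. \<theta> x = f x"
      using XS \<phi>X by (auto simp: \<theta>_def)
    ultimately show "\<exists>\<theta>. \<theta> \<in> skew_left_brace_hom (G\<lparr>carrier := S\<rparr>) (?C\<lparr>carrier := S\<rparr>) A' C'
        \<inter> extensional (carrier (G\<lparr>carrier := S\<rparr>)) \<and> (\<forall>x\<in>X. \<theta> x = f x)"
      by auto
  next
    fix A' C' :: "'b monoid" and f h k
    assume *: "skew_left_brace A' C' \<and> f \<in> X \<rightarrow> carrier A'"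
      and h: "h \<in> skew_left_brace_hom (G\<lparr>carrier := S\<rparr>) (?C\<lparr>carrier := S\<rparr>) A' C'
        \<inter> extensional (carrier (G\<lparr>carrier := S\<rparr>)) \<and> (\<forall>x\<in>X. h x = f x)"
      and k: "k \<in> skew_left_brace_hom (G\<lparr>carrier := S\<rparr>) (?C\<lparr>carrier := S\<rparr>) A' C'
        \<inter> extensional (carrier (G\<lparr>carrier := S\<rparr>)) \<and> (\<forall>x\<in>X. k x = f x)"
    show "h = k"
    proof (rule extensionalityI)
      show "h x = k x" if "x \<in> S" for x
        using G.skew_left_brace_hom_unique[OF X, of A' C' h k x] * h k that by (simp add: S_def)
    qed (use h k in auto)
  qed
qed

end
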